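(* Let $k$ be a positive odd integer. Then there exists a tournament $T$ with $\det(T)=k^2$.
   Context: A tournament is a directed graph with exactly one arc between each pair of distinct vertices. For a tournament $T$ on vertices $v_1,\dots,v_n$, its skew-adjacency matrix is the $n\times n$ zero-diagonal matrix $S_T=[s_{ij}]$ with $s_{ij}=-s_{ji}=1$ if there is an arc from $v_i$ to $v_j$, and $\det(T):=\det(S_T)$. *)

theory Defs
  imports "Graph_Theory.Pair_Digraph" "Jordan_Normal_Form.Determinant"
begin

definition tournament :: "'a pair_pre_digraph \<Rightarrow> bool" where
  "tournament T \<longleftrightarrow> pair_digraph T \<and> pverts T \<noteq> {} \<and>
     (\<forall>u\<in>pverts T. \<forall>v\<in>pverts T. u \<noteq> v \<longrightarrow> ((u, v) \<in> parcs T) \<noteq> ((v, u) \<in> parcs T))"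

text \<open>The list \<open>vs\<close> enumerates the vertices.\<close>

definition skew_adj_mat :: "'a pair_pre_digraph \<Rightarrow> 'a list \<Rightarrow> int mat" where
  "skew_adj_mat T vs = mat (length vs) (length vs) (\<lambda>(i, j).
     if i = j then 0
     else if (vs ! i, vs ! j) \<in> parcs T then 1
     else if (vs ! j, vs ! i) \<in> parcs T then - 1
     else 0)"

text \<open>The enumeration is chosen arbitrarily; by \<open>tournament_det_eq\<close> below the value does
  not depend on the choice.\<close>

definition tournament_det :: "'a pair_pre_digraph \<Rightarrow> int" where
  "tournament_det T = det (skew_adj_mat T (SOME vs. distinct vs \<and> set vs = pverts T))"

lemma det_permute_rows_cols:
  fixes A :: "'a :: comm_ring_1 mat"
  assumes A: "A \<in> carrier_mat n n" and p: "p permutes {0..<n}"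
  shows "det (mat n n (\<lambda>(i, j). A $$ (p i, p j))) = det A"
proof -
  let ?B = "mat n n (\<lambda>(i, j). A $$ (p i, j))"
  let ?C = "transpose_mat ?B"
  have C: "?C \<in> carrier_mat n n" by simp
  have pn: "p i < n" if "i < n" for i
    using permutes_in_image[OF p, of i] that by simp
  have "mat n n (\<lambda>(i, j). A $$ (p i, p j)) = transpose_mat (mat n n (\<lambda>(i, j). ?C $$ (p i, j)))"
    by (rule eq_matI) (auto simp: pn)
  hence "det (mat n n (\<lambda>(i, j). A $$ (p i, p j))) = det (mat n n (\<lambda>(i, j). ?C $$ (p i, j)))"
    by (simp add: det_transpose[of _ n])
  also have "\<dots> = signof p * det ?C"
    by (rule det_permute_rows[OF C p])
  also have "det ?C = signof p * det A"
    using det_permute_rows[OF A p] det_transpose[of ?B n] by simp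
  finally show ?thesis
    by (simp add: sign_def)
qed

lemma det_skew_adj_mat_unique:
  assumes "distinct vs" "distinct ws" "set vs = set ws"
  shows "det (skew_adj_mat T vs) = det (skew_adj_mat T ws)"
proof -
  have "mset vs = mset ws"
    using assms set_eq_iff_mset_eq_distinct by blast
  then obtain p where p: "p permutes {..<length ws}" and vs: "permute_list p ws = vs"
    using mset_eq_permutation by metis
  let ?n = "length ws"
  have len: "length vs = ?n"
    using vs by auto
  have p': "p permutes {0..<?n}"
    using p by (simp add: atLeast0LessThan)
  have pn: "p i < ?n" if "i < ?n" for i
    using permutes_in_image[OF p, of i] that by simp
  have nth: "vs ! i = ws ! p i" if "i < ?n" for i
    using permute_list_nth[OF p that] vs by simp
  have inj: "p i = p j \<longleftrightarrow> i = j" for i j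
    using permutes_inj[OF p] by (auto dest: injD)
  have "skew_adj_mat T vs = mat ?n ?n (\<lambda>(i, j). skew_adj_mat T ws $$ (p i, p j))"
    by (rule eq_matI) (auto simp: skew_adj_mat_def len nth pn inj)
  thus ?thesis
    using det_permute_rows_cols[OF _ p', of "skew_adj_mat T ws"]
    by (simp add: skew_adj_mat_def)
qed

lemma tournament_det_eq:
  assumes "distinct vs" "set vs = pverts T"
  shows "tournament_det T = det (skew_adj_mat T vs)"
proof -
  have "distinct (SOME vs. distinct vs \<and> set vs = pverts T) \<and>
        set (SOME vs. distinct vs \<and> set vs = pverts T) = pverts T"
    by (rule someI[of _ vs]) (use assms in simp)
  thus ?thesis
    unfolding tournament_det_def using assms by (intro det_skew_adj_mat_unique) auto
qed

end

theory Submission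
  imports Defs
begin

text \<open>Let \<open>S\<close> be the skew-adjacency matrix of the transitive tournament on an odd number \<open>k\<close> of
  vertices. It annihilates the alternating vector \<open>w = (1, -1, \<dots>, 1)\<close>, and so does its transpose.
  Bordering a matrix that has such kernel vectors on both sides by a column \<open>x\<close> and a row \<open>y\<close>
  gives, by Cramer's rule applied once to columns and once to rows, \<open>- (w \<bullet> x) (y \<bullet> w)\<close> times the
  minor that omits the first row and column of \<open>S\<close>. For \<open>x = (1, \<dots>, 1) = - y\<close> this shows
  inductively that the transitive tournaments of even order, which are also these minors, have
  determinant 1. Adding a vertex dominated by exactly the vertices of even index means \<open>x = w = - y\<close>,
  which then gives \<open>(w \<bullet> w)\<^sup>2 = k\<^sup>2\<close>.\<close>

lemma vec_index_mult_det_eq_cofactor: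
  fixes A :: "'a :: comm_ring_1 mat"
  assumes A: "A \<in> carrier_mat n n" and v: "v \<in> carrier_vec n"
    and Av: "A *\<^sub>v v = c \<cdot>\<^sub>v unit_vec n i" and "i < n" "j < n"
  shows "v $ j * det A = c * cofactor A i j"
proof -
  note adj = adj_mat[OF A]
  have "det A \<cdot>\<^sub>v v = (det A \<cdot>\<^sub>m 1\<^sub>m n) *\<^sub>v v"
    using v by auto
  also have "\<dots> = adj_mat A *\<^sub>v (A *\<^sub>v v)"
    using assoc_mult_mat_vec[OF adj(1) A v] adj(3) by simp
  also have "\<dots> = c \<cdot>\<^sub>v col (adj_mat A) i"
    using adj(1) \<open>i < n\<close> by (intro eq_vecI) (auto simp: Av)
  finally have "(det A \<cdot>\<^sub>v v) $ j = (c \<cdot>\<^sub>v col (adj_mat A) i) $ j"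
    by simp
  thus ?thesis
    using A v \<open>i < n\<close> \<open>j < n\<close> by (simp add: adj_mat_def mult.commute)
qed

lemma cofactor_transpose_mat:
  fixes A :: "'a :: comm_ring_1 mat"
  assumes A: "A \<in> carrier_mat n n" and "i < n" "j < n"
  shows "cofactor (transpose_mat A) i j = cofactor A j i"
proof -
  have "mat_delete (transpose_mat A) i j = transpose_mat (mat_delete A j i)"
    using assms by (intro eq_matI) (auto simp: mat_delete_def)
  thus ?thesis
    using det_transpose[OF mat_delete_carrier[OF A]] by (simp add: cofactor_def add.commute)
qed

lemma vec_index_mult_det_eq_cofactor_transpose:
  fixes A :: "'a :: comm_ring_1 mat"
  assumes A: "A \<in> carrier_mat n n" and u: "u \<in> carrier_vec n"
    and Au: "transpose_mat A *\<^sub>v u = c \<cdot>\<^sub>v unit_vec n j" and ij: "i < n" "j < n"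
  shows "u $ i * det A = c * cofactor A i j"
  using vec_index_mult_det_eq_cofactor[OF transpose_carrier_mat[THEN iffD2, OF A] u Au ij(2,1)]
  by (simp add: det_transpose[OF A] cofactor_transpose_mat[OF A ij(2,1)])

definition bordered_mat :: "'a :: zero mat \<Rightarrow> 'a vec \<Rightarrow> 'a vec \<Rightarrow> 'a \<Rightarrow> 'a mat" where
  "bordered_mat A x y z =
     four_block_mat A (transpose_mat (mat_of_row x)) (mat_of_row y) (mat 1 1 (\<lambda>_. z))"

lemma dim_bordered_mat [simp]:
  "dim_row (bordered_mat A x y z) = Suc (dim_row A)"
  "dim_col (bordered_mat A x y z) = Suc (dim_col A)"
  by (simp_all add: bordered_mat_def)

lemma bordered_mat_carrier [simp]:
  "A \<in> carrier_mat m n \<Longrightarrow> bordered_mat A x y z \<in> carrier_mat (Suc m) (Suc n)"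
  by (rule carrier_matI) auto

lemma index_bordered_mat:
  assumes "A \<in> carrier_mat m n" "x \<in> carrier_vec m" "y \<in> carrier_vec n" "i \<le> m" "j \<le> n"
  shows "bordered_mat A x y z $$ (i, j) =
    (if i < m then if j < n then A $$ (i, j) else x $ i else if j < n then y $ j else z)"
  using assms by (auto simp: bordered_mat_def)

lemma bordered_mat_mult_kernel_vec:
  fixes A :: "'a :: comm_ring_1 mat"
  assumes A: "A \<in> carrier_mat m n" and x: "x \<in> carrier_vec m" and y: "y \<in> carrier_vec n"
    and v: "v \<in> carrier_vec n" and Av: "A *\<^sub>v v = 0\<^sub>v m"
  shows "bordered_mat A x y z *\<^sub>v (v @\<^sub>v 0\<^sub>v 1) = (y \<bullet> v) \<cdot>\<^sub>v unit_vec (Suc m) m"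
proof -
  have "bordered_mat A x y z *\<^sub>v (v @\<^sub>v 0\<^sub>v 1) =
    (A *\<^sub>v v + transpose_mat (mat_of_row x) *\<^sub>v 0\<^sub>v 1) @\<^sub>v
    (mat_of_row y *\<^sub>v v + mat 1 1 (\<lambda>_. z) *\<^sub>v 0\<^sub>v 1)"
    unfolding bordered_mat_def by (rule four_block_mat_mult_vec[OF A _ _ _ v]) (use x y in auto)
  also have "\<dots> = (y \<bullet> v) \<cdot>\<^sub>v unit_vec (Suc m) m"
    using x by (intro eq_vecI) (auto simp: Av scalar_prod_def)
  finally show ?thesis .
qed

lemma transpose_minor_bordered_mat_mult_kernel_vec:
  fixes A :: "'a :: comm_ring_1 mat"
  assumes A: "A \<in> carrier_mat m n" and x: "x \<in> carrier_vec m" and y: "y \<in> carrier_vec n"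
    and u: "u \<in> carrier_vec m" and Au: "transpose_mat A *\<^sub>v u = 0\<^sub>v n" and "j < n"
  shows "transpose_mat (mat_delete (bordered_mat A x y z) m j) *\<^sub>v u =
    (u \<bullet> x) \<cdot>\<^sub>v unit_vec n (n - 1)" (is "transpose_mat ?N *\<^sub>v u = _")
proof (rule eq_vecI)
  fix l assume "l < dim_vec ((u \<bullet> x) \<cdot>\<^sub>v unit_vec n (n - 1))"
  hence l: "l < n" by simp
  have "(transpose_mat ?N *\<^sub>v u) $ l = col ?N l \<bullet> u"
    using A l by simp
  also have "\<dots> = (u \<bullet> x) * of_bool (l = n - 1)"
  proof (cases "l = n - 1")
    case True
    have "col ?N l = x"
      using A x y l True \<open>j < n\<close> by (intro eq_vecI) (auto simp: mat_delete_def index_bordered_mat)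
    thus ?thesis
      using True comm_scalar_prod[OF u x] by simp
  next
    case False
    define c where "c = (if l < j then l else Suc l)"
    have c_less: "c < n"
      using False l by (auto simp: c_def)
    have "col ?N l = col A c"
      using A x y l c_less False
      by (intro eq_vecI) (auto simp: mat_delete_def index_bordered_mat c_def)
    also have "col A c \<bullet> u = (transpose_mat A *\<^sub>v u) $ c"
      using A c_less by simp
    finally show ?thesis
      using False c_less by (simp add: Au)
  qed
  also have "\<dots> = ((u \<bullet> x) \<cdot>\<^sub>v unit_vec n (n - 1)) $ l"
    using l by simp
  finally show "(transpose_mat ?N *\<^sub>v u) $ l = ((u \<bullet> x) \<cdot>\<^sub>v unit_vec n (n - 1)) $ l" .
qed (use A in simp)

lemma mat_delete_mat_delete_bordered_mat:
  assumes "A \<in> carrier_mat n n" "x \<in> carrier_vec n" "y \<in> carrier_vec n" "i < n" "j < n"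
  shows "mat_delete (mat_delete (bordered_mat A x y z) n j) i (n - 1) = mat_delete A i j"
  using assms by (intro eq_matI) (simp_all add: mat_delete_def index_bordered_mat less_diff_conv)

lemma det_minor_bordered_mat_kernel:
  fixes A :: "'a :: comm_ring_1 mat"
  assumes A: "A \<in> carrier_mat n n" and x: "x \<in> carrier_vec n" and y: "y \<in> carrier_vec n"
    and u: "u \<in> carrier_vec n" "transpose_mat A *\<^sub>v u = 0\<^sub>v n" and i: "i < n" and j: "j < n"
  shows "u $ i * det (mat_delete (bordered_mat A x y z) n j) =
    (u \<bullet> x) * ((- 1) ^ (i + (n - 1)) * det (mat_delete A i j))"
proof -
  let ?N = "mat_delete (bordered_mat A x y z) n j"
  have N: "?N \<in> carrier_mat n n"
    using mat_delete_carrier[OF bordered_mat_carrier[OF A]] by simp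
  have "u $ i * det ?N = (u \<bullet> x) * cofactor ?N i (n - 1)"
    using transpose_minor_bordered_mat_mult_kernel_vec[OF A x y u j] N u(1) i
    by (intro vec_index_mult_det_eq_cofactor_transpose) auto
  thus ?thesis
    by (simp only: cofactor_def mat_delete_mat_delete_bordered_mat[OF A x y i j])
qed

lemma det_bordered_mat_kernel:
  fixes A :: "'a :: comm_ring_1 mat"
  assumes A: "A \<in> carrier_mat n n" and x: "x \<in> carrier_vec n" and y: "y \<in> carrier_vec n"
    and u: "u \<in> carrier_vec n" "transpose_mat A *\<^sub>v u = 0\<^sub>v n"
    and v: "v \<in> carrier_vec n" "A *\<^sub>v v = 0\<^sub>v n"
    and i: "i < n" and j: "j < n"
  shows "u $ i * v $ j * det (bordered_mat A x y z) = - ((u \<bullet> x) * (y \<bullet> v) * cofactor A i j)"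
proof -
  let ?M = "bordered_mat A x y z"
  have "v @\<^sub>v 0\<^sub>v 1 \<in> carrier_vec (Suc n)"
    using append_carrier_vec[OF v(1) zero_carrier_vec[of 1]] by simp
  hence "(v @\<^sub>v 0\<^sub>v 1) $ j * det ?M = (y \<bullet> v) * cofactor ?M n j"
    using bordered_mat_mult_kernel_vec[OF A x y v] A j
    by (intro vec_index_mult_det_eq_cofactor[where n = "Suc n"]) auto
  hence det_eq_cofactor: "v $ j * det ?M = (y \<bullet> v) * cofactor ?M n j"
    using v(1) j by simp
  have sign: "(- 1) ^ (n + j) * (- 1) ^ (i + (n - 1)) = (- ((- 1) ^ (i + j)) :: 'a)"
    using i by (cases n) (auto simp: minus_one_power_iff)
  have "u $ i * v $ j * det ?M =
    (y \<bullet> v) * (- 1) ^ (n + j) * (u $ i * det (mat_delete ?M n j))"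
    using det_eq_cofactor by (simp add: cofactor_def algebra_simps)
  also have "\<dots> = (u \<bullet> x) * (y \<bullet> v) * ((- 1) ^ (n + j) * (- 1) ^ (i + (n - 1))) *
    det (mat_delete A i j)"
    unfolding det_minor_bordered_mat_kernel[OF A x y u i j] by (simp add: mult_ac)
  finally show ?thesis
    unfolding sign cofactor_def by (simp add: mult_ac)
qed

definition transitive_mat :: "nat \<Rightarrow> 'a :: comm_ring_1 mat" where
  "transitive_mat n = mat n n (\<lambda>(i, j). if i < j then 1 else if j < i then - 1 else 0)"

definition alternating_vec :: "nat \<Rightarrow> 'a :: comm_ring_1 vec" where
  "alternating_vec n = vec n (\<lambda>i. (- 1) ^ i)"

lemma transitive_mat_carrier [simp]: "transitive_mat n \<in> carrier_mat n n"
  by (simp add: transitive_mat_def)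

lemma alternating_vec_carrier [simp]: "alternating_vec n \<in> carrier_vec n"
  by (simp add: alternating_vec_def)

lemma alternating_vec_scalar_prod_vec:
  "alternating_vec n \<bullet> vec n f = (\<Sum>i<n. (- 1) ^ i * f i)"
  by (simp add: alternating_vec_def scalar_prod_def atLeast0LessThan)

lemma transpose_transitive_mat: "transpose_mat (transitive_mat n) = - transitive_mat n"
  by (rule eq_matI) (auto simp: transitive_mat_def)

lemma transitive_mat_Suc:
  "transitive_mat (Suc n) = bordered_mat (transitive_mat n) (vec n (\<lambda>_. 1)) (- vec n (\<lambda>_. 1)) 0"
  by (rule eq_matI) (auto simp: index_bordered_mat[of _ n n] transitive_mat_def)

lemma mat_delete_transitive_mat_Suc:
  assumes "i \<le> n"
  shows "mat_delete (transitive_mat (Suc n)) i i = transitive_mat n"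
  by (rule eq_matI) (use assms in \<open>simp_all add: mat_delete_def transitive_mat_def\<close>)

lemma sum_alternating: "(\<Sum>i<n. (- 1) ^ i) = (of_bool (odd n) :: 'a :: comm_ring_1)"
  by (induction n) auto

lemma transitive_mat_mult_alternating_vec:
  assumes "odd n"
  shows "transitive_mat n *\<^sub>v alternating_vec n = (0\<^sub>v n :: 'a :: comm_ring_1 vec)"
proof (rule eq_vecI)
  define s :: "nat \<Rightarrow> nat \<Rightarrow> 'a"
    where "s i j = (if i < j then 1 else if j < i then - 1 else 0)" for i j
  have partial_sum: "(\<Sum>j<l. s i j * (- 1) ^ j) =
    - of_bool (if i < l then even l else odd l)" for i l
    by (induction l) (auto simp: s_def less_Suc_eq)
  fix i assume "i < dim_vec (0\<^sub>v n :: 'a vec)"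
  thus "(transitive_mat n *\<^sub>v alternating_vec n) $ i = (0\<^sub>v n :: 'a vec) $ i"
    using partial_sum[of i n] \<open>odd n\<close>
    by (simp add: transitive_mat_def alternating_vec_def scalar_prod_def s_def atLeast0LessThan)
qed (simp add: transitive_mat_def)

lemma det_bordered_transitive_mat_odd:
  fixes x y :: "'a :: comm_ring_1 vec"
  assumes "odd n" and x: "x \<in> carrier_vec n" and y: "y \<in> carrier_vec n"
  shows "det (bordered_mat (transitive_mat n) x y z) =
    - ((alternating_vec n \<bullet> x) * (alternating_vec n \<bullet> y) * det (transitive_mat (n - 1)))"
proof -
  let ?A = "transitive_mat n :: 'a mat" and ?w = "alternating_vec n :: 'a vec"
  have "n > 0"
    using \<open>odd n\<close> by (rule odd_pos)
  have kernel: "?A *\<^sub>v ?w = 0\<^sub>v n"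
    using \<open>odd n\<close> by (rule transitive_mat_mult_alternating_vec)
  have left_kernel: "transpose_mat ?A *\<^sub>v ?w = 0\<^sub>v n"
    using uminus_mult_mat_vec[of ?w ?A] kernel
    by (simp add: transpose_transitive_mat carrier_vecD[OF alternating_vec_carrier]
        carrier_matD[OF transitive_mat_carrier])
  have "?w $ 0 * ?w $ 0 * det (bordered_mat ?A x y z) =
    - ((?w \<bullet> x) * (y \<bullet> ?w) * cofactor ?A 0 0)"
    using kernel left_kernel x y \<open>n > 0\<close> by (intro det_bordered_mat_kernel) auto
  moreover have "?w $ 0 = 1"
    using \<open>n > 0\<close> by (simp add: alternating_vec_def)
  moreover have "cofactor ?A 0 0 = det (transitive_mat (n - 1))"
    using mat_delete_transitive_mat_Suc[of 0 "n - 1", where ?'a = 'a] \<open>n > 0\<close>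
    by (simp add: cofactor_def)
  ultimately show ?thesis
    using comm_scalar_prod[OF y, of ?w] by simp
qed

lemma det_transitive_mat_even:
  assumes "even n"
  shows "det (transitive_mat n) = (1 :: 'a :: comm_ring_1)"
  using assms
proof (induction n rule: less_induct)
  case (less n)
  show ?case
  proof (cases n)
    case 0
    thus ?thesis by (simp add: det_def transitive_mat_def)
  next
    case (Suc m)
    have "odd m"
      using \<open>even n\<close> Suc by simp
    let ?e = "vec m (\<lambda>_. 1) :: 'a vec"
    have "alternating_vec m \<bullet> ?e = 1"
      using \<open>odd m\<close> by (simp add: alternating_vec_scalar_prod_vec sum_alternating)
    moreover have "det (transitive_mat (m - 1)) = (1 :: 'a)"
      using less.IH[of "m - 1"] Suc \<open>odd m\<close> by simp
    ultimately show ?thesis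
      using \<open>odd m\<close> unfolding Suc transitive_mat_Suc
      by (simp add: det_bordered_transitive_mat_odd alternating_vec_def)
  qed
qed

definition apex_tournament :: "nat \<Rightarrow> nat set \<Rightarrow> nat pair_pre_digraph" where
  "apex_tournament k X = \<lparr>pverts = {..k},
     parcs = {(i, j). i < j \<and> j < k} \<union> {(i, k) |i. i < k \<and> i \<in> X} \<union> {(k, i) |i. i < k \<and> i \<notin> X}\<rparr>"

lemma tournament_apex_tournament: "tournament (apex_tournament k X)"
proof -
  let ?T = "apex_tournament k X"
  have "parcs ?T \<subseteq> {..k} \<times> {..k}"
    by (auto simp: apex_tournament_def)
  hence "finite (parcs ?T)"
    by (rule finite_subset) simp
  hence "pair_digraph ?T"
    by unfold_locales (auto simp: apex_tournament_def)
  thus ?thesis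
    unfolding tournament_def
  proof (intro conjI ballI impI)
    show "pverts ?T \<noteq> {}"
      by (simp add: apex_tournament_def)
    fix u v assume "u \<in> pverts ?T" "v \<in> pverts ?T" "u \<noteq> v"
    thus "((u, v) \<in> parcs ?T) \<noteq> ((v, u) \<in> parcs ?T)"
      by (cases u v rule: linorder_cases) (auto simp: apex_tournament_def)
  qed
qed

lemma skew_adj_mat_apex_tournament:
  fixes X :: "nat set"
  defines "x k \<equiv> vec k (\<lambda>i. if i \<in> X then 1 else - 1)"
  shows "skew_adj_mat (apex_tournament k X) [0..<Suc k] =
    bordered_mat (transitive_mat k) (x k) (- x k) 0"
  by (rule eq_matI)
    (auto simp: skew_adj_mat_def apex_tournament_def index_bordered_mat[of _ k k] x_def
      transitive_mat_def simp del: upt_Suc)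

lemma tournament_det_apex_tournament:
  assumes "odd k"
  shows "tournament_det (apex_tournament k X) =
    (\<Sum>i<k. (- 1) ^ i * (if i \<in> X then 1 else - 1))\<^sup>2"
proof -
  let ?x = "vec k (\<lambda>i. if i \<in> X then 1 else - 1) :: int vec"
  have "tournament_det (apex_tournament k X) =
    det (skew_adj_mat (apex_tournament k X) [0..<Suc k])"
    by (rule tournament_det_eq) (auto simp: apex_tournament_def)
  also have "\<dots> = (alternating_vec k \<bullet> ?x)\<^sup>2"
    using assms unfolding skew_adj_mat_apex_tournament
    by (simp add: det_bordered_transitive_mat_odd det_transitive_mat_even alternating_vec_def
        power2_eq_square)
  finally show ?thesis
    by (simp add: alternating_vec_scalar_prod_vec)
qed

theorem theorem4p4:
  fixes k :: int
  assumes "k > 0" and "odd k"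
  shows "\<exists>T :: nat pair_pre_digraph. tournament T \<and> tournament_det T = k\<^sup>2"
proof -
  let ?T = "apex_tournament (nat k) {i. even i}"
  have "odd (nat k)"
    using assms by (simp add: even_nat_iff)
  hence "tournament_det ?T =
    (\<Sum>i<nat k. (- 1) ^ i * (if i \<in> {i. even i} then 1 else - 1))\<^sup>2"
    by (rule tournament_det_apex_tournament)
  also have "\<dots> = (\<Sum>i<nat k. 1)\<^sup>2"
    by (intro arg_cong[where f = "\<lambda>s. s\<^sup>2"] sum.cong) auto
  also have "\<dots> = k\<^sup>2"
    using \<open>k > 0\<close> by simp
  finally show ?thesis
    using tournament_apex_tournament by blast
qed

end
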